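(* Let $P$ be a finite set of atomic propositions, $T>0$, $\mathbb{T}=[0,T)$, let $x:\mathbb{T}\to 2^P$ be a piecewise-constant càdlàg signal, and let $\varphi$ be an MTL formula in positive normal form whose temporal operators carry closed intervals $[a,b]$, $a,b\in\mathbb{N}$, $a\le b$. Then for every $i\in\mathbb{T}$: if $\llbracket x,\varphi\rrbracket(i)>0$ then $(x,i)\models\varphi$; and if $(x,i)\not\models\varphi$ then $\llbracket x,\varphi\rrbracket(i)=0$.
   Context: Càdlàg piecewise constant: each $x_p$ ($x_p(t)=1$ iff $p\in x(t)$, else $0$) changes value finitely often, is right-continuous and has left limits everywhere. Positive normal form: $\varphi::=p\mid\neg p\mid\varphi\vee\psi\mid\varphi\wedge\psi\mid F_I\varphi\mid G_I\varphi\mid P_I\varphi\mid H_I\varphi\mid\varphi U_I\psi\mid\varphi S_I\psi$. Classical semantics $\models$: $p$ iff $x_p(i)=1$; $\neg p,\vee,\wedge$ as usual; $F_I\varphi$: $\exists j\in(i+I)\cap\mathbb{T}$ with $(x,j)\models\varphi$; $G_I\varphi$: $\forall j\in(i+I)\cap\mathbb{T}$; $P_I\varphi$, $H_I\varphi$: same with $i-I$; $\varphi U_I\psi$: $\exists j\in(i+I)\cap\mathbb{T}$ with $(x,j)\models\psi$ and $(x,k)\models\varphi$ for all real $k\in(i,j)$; $\varphi S_I\psi$: $\exists j\in(i-I)\cap\mathbb{T}$ with $(x,j)\models\psi$ and $(x,k)\models\varphi$ for all $k\in(j,i)$. Quantitative semantics: for $I=[a,b]$ with $a<b$, $w^+_I(t)=\frac1{b-a}$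 if $t\in[-b,-a]$ and $0$ otherwise, $w^-_I(t)=\frac1{b-a}$ if $t\in[a,b]$ and $0$ otherwise; for $I=[a,a]$ the windows are Dirac deltas, so that $\int_{\mathbb{T}} f(j)w^+_{[a,a]}(i-j)\,dj=f(i+a)$ and $\int_{\mathbb{T}}f(j)w^-_{[a,a]}(i-j)\,dj=f(i-a)$ (taken as $0$ if the point lies outside $\mathbb{T}$). Then $\llbracket x,p\rrbracket(i)=x_p(i)$; $\llbracket x,\neg p\rrbracket(i)=1-x_p(i)$; $\vee\mapsto\max$, $\wedge\mapsto\min$ pointwise; $\llbracket x,F_I\varphi\rrbracket(i)=\int_{\mathbb{T}}\llbracket x,\varphi\rrbracket(j)\,w^+_I(i-j)\,dj$; $\llbracket x,P_I\varphi\rrbracket(i)=\int_{\mathbb{T}}\llbracket x,\varphi\rrbracket(j)\,w^-_I(i-j)\,dj$; $\llbracket x,G_I\varphi\rrbracket(i)=\inf_{j\in(i+I)\cap\mathbb{T}}\llbracket x,\varphi\rrbracket(j)$; $\llbracket x,H_I\varphi\rrbracket(i)=\inf_{j\in(i-I)\cap\mathbb{T}}\llbracket x,\varphi\rrbracket(j)$ (infimum over the empty set is $1$; $G_{(0,j)}$, $H_{(0,j)}$ use the open interval $(0,j)$ in the same way); $\llbracket x,\varphi U_I\psi\rrbracket(i)=\frac1{b-a}\int_a^b\llbracket x,G_{(0,j)}\varphi\rrbracket(i)\cdot\llbracket x,F_{[j,j]}\psi\rrbracket(i)\,dj$ and $\llbracket x,\varphi S_I\psi\rrbracket(i)=\frac1{b-a}\int_a^b\llbracket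 x,H_{(0,j)}\varphi\rrbracket(i)\cdot\llbracket x,P_{[j,j]}\psi\rrbracket(i)\,dj$ for $a<b$, and these two values are $0$ when $a=b$. *)

theory Defs
  imports "HOL-Analysis.Analysis"
begin

text \<open>MTL formulas in positive normal form. A temporal operator with arguments \<open>a b\<close> carries the
  closed interval \<open>[a, b]\<close>.\<close>

datatype (atoms: 'p) mtl =
    Atom 'p
  | NegAtom 'p
  | Or "'p mtl" "'p mtl"
  | And "'p mtl" "'p mtl"
  | Eventually nat nat "'p mtl"
  | Globally nat nat "'p mtl"
  | Previously nat nat "'p mtl"
  | Historically nat nat "'p mtl"
  | Until nat nat "'p mtl" "'p mtl"
  | Since nat nat "'p mtl" "'p mtl"

primrec proper_intervals :: "'p mtl \<Rightarrow> bool" where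
  "proper_intervals (Atom p) = True"
| "proper_intervals (NegAtom p) = True"
| "proper_intervals (Or \<phi> \<psi>) = (proper_intervals \<phi> \<and> proper_intervals \<psi>)"
| "proper_intervals (And \<phi> \<psi>) = (proper_intervals \<phi> \<and> proper_intervals \<psi>)"
| "proper_intervals (Eventually a b \<phi>) = (a \<le> b \<and> proper_intervals \<phi>)"
| "proper_intervals (Globally a b \<phi>) = (a \<le> b \<and> proper_intervals \<phi>)"
| "proper_intervals (Previously a b \<phi>) = (a \<le> b \<and> proper_intervals \<phi>)"
| "proper_intervals (Historically a b \<phi>) = (a \<le> b \<and> proper_intervals \<phi>)"
| "proper_intervals (Until a b \<phi> \<psi>) = (a \<le> b \<and> proper_intervals \<phi> \<and> proper_intervals \<psi>)"
| "proper_intervals (Since a b \<phi> \<psi>) = (a \<le> b \<and> proper_intervals \<phi> \<and> proper_intervals \<psi>)"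

text \<open>Signals on the time domain \<open>[0, T)\<close> are total functions on the reals; their values outside
  \<open>[0, T)\<close> do not influence either semantics at times in \<open>[0, T)\<close>.\<close>

definition component :: "(real \<Rightarrow> 'p set) \<Rightarrow> 'p \<Rightarrow> real \<Rightarrow> real" where
  "component x p t = (if p \<in> x t then 1 else 0)"

definition finitely_many_changes :: "real \<Rightarrow> (real \<Rightarrow> real) \<Rightarrow> bool" where
  "finitely_many_changes T f \<longleftrightarrow>
     (\<exists>D. finite D \<and> (\<forall>s t. 0 \<le> s \<and> s \<le> t \<and> t < T \<and> {s..t} \<inter> D = {} \<longrightarrow> f s = f t))"

definition cadlag_on :: "real \<Rightarrow> (real \<Rightarrow> real) \<Rightarrow> bool" where
  "cadlag_on T f \<longleftrightarrow>
     (\<forall>t\<in>{0..<T}. continuous (at_right t) f) \<and>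
     (\<forall>t\<in>{0<..<T}. \<exists>l. (f \<longlongrightarrow> l) (at_left t))"

definition pc_cadlag_signal :: "'p set \<Rightarrow> real \<Rightarrow> (real \<Rightarrow> 'p set) \<Rightarrow> bool" where
  "pc_cadlag_signal P T x \<longleftrightarrow>
     (\<forall>t\<in>{0..<T}. x t \<subseteq> P) \<and>
     (\<forall>p\<in>P. finitely_many_changes T (component x p) \<and> cadlag_on T (component x p))"

definition future :: "real \<Rightarrow> real \<Rightarrow> real set \<Rightarrow> real set" where
  "future T i I = (\<lambda>s. i + s) ` I \<inter> {0..<T}"

definition past :: "real \<Rightarrow> real \<Rightarrow> real set \<Rightarrow> real set" where
  "past T i I = (\<lambda>s. i - s) ` I \<inter> {0..<T}"

primrec sat :: "real \<Rightarrow> (real \<Rightarrow> 'p set) \<Rightarrow> 'p mtl \<Rightarrow> real \<Rightarrow> bool" where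
  "sat T x (Atom p) i = (component x p i = 1)"
| "sat T x (NegAtom p) i = (\<not> component x p i = 1)"
| "sat T x (Or \<phi> \<psi>) i = (sat T x \<phi> i \<or> sat T x \<psi> i)"
| "sat T x (And \<phi> \<psi>) i = (sat T x \<phi> i \<and> sat T x \<psi> i)"
| "sat T x (Eventually a b \<phi>) i = (\<exists>j\<in>future T i {real a..real b}. sat T x \<phi> j)"
| "sat T x (Globally a b \<phi>) i = (\<forall>j\<in>future T i {real a..real b}. sat T x \<phi> j)"
| "sat T x (Previously a b \<phi>) i = (\<exists>j\<in>past T i {real a..real b}. sat T x \<phi> j)"
| "sat T x (Historically a b \<phi>) i = (\<forall>j\<in>past T i {real a..real b}. sat T x \<phi> j)"
| "sat T x (Until a b \<phi> \<psi>) i =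
     (\<exists>j\<in>future T i {real a..real b}. sat T x \<psi> j \<and> (\<forall>k\<in>{i<..<j}. sat T x \<phi> k))"
| "sat T x (Since a b \<phi> \<psi>) i =
     (\<exists>j\<in>past T i {real a..real b}. sat T x \<psi> j \<and> (\<forall>k\<in>{j<..<i}. sat T x \<phi> k))"

text \<open>Windows for \<open>a < b\<close>. For \<open>a = b\<close> the window is a Dirac delta, which \<open>q_eventually\<close> and
  \<open>q_previously\<close> render by point evaluation.\<close>

definition w_plus :: "real \<Rightarrow> real \<Rightarrow> real \<Rightarrow> real" where
  "w_plus a b t = (if t \<in> {-b..-a} then 1 / (b - a) else 0)"

definition w_minus :: "real \<Rightarrow> real \<Rightarrow> real \<Rightarrow> real" where
  "w_minus a b t = (if t \<in> {a..b} then 1 / (b - a) else 0)"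

definition q_eventually :: "real \<Rightarrow> real \<Rightarrow> real \<Rightarrow> (real \<Rightarrow> real) \<Rightarrow> real \<Rightarrow> real" where
  "q_eventually T a b f i =
     (if a < b then (LINT j:{0..<T}|lborel. f j * w_plus a b (i - j))
      else if i + a \<in> {0..<T} then f (i + a) else 0)"

definition q_previously :: "real \<Rightarrow> real \<Rightarrow> real \<Rightarrow> (real \<Rightarrow> real) \<Rightarrow> real \<Rightarrow> real" where
  "q_previously T a b f i =
     (if a < b then (LINT j:{0..<T}|lborel. f j * w_minus a b (i - j))
      else if i - a \<in> {0..<T} then f (i - a) else 0)"

definition q_inf :: "real set \<Rightarrow> (real \<Rightarrow> real) \<Rightarrow> real" where
  "q_inf J f = (if J = {} then 1 else (INF j\<in>J. f j))"

definition q_globally :: "real \<Rightarrow> real set \<Rightarrow> (real \<Rightarrow> real) \<Rightarrow> real \<Rightarrow> real" where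
  "q_globally T I f i = q_inf (future T i I) f"

definition q_historically :: "real \<Rightarrow> real set \<Rightarrow> (real \<Rightarrow> real) \<Rightarrow> real \<Rightarrow> real" where
  "q_historically T I f i = q_inf (past T i I) f"

definition q_until ::
  "real \<Rightarrow> real \<Rightarrow> real \<Rightarrow> (real \<Rightarrow> real) \<Rightarrow> (real \<Rightarrow> real) \<Rightarrow> real \<Rightarrow> real" where
  "q_until T a b f g i =
     (if a < b
      then 1 / (b - a) *
        (LINT j:{a..b}|lborel. q_globally T {0<..<j} f i * q_eventually T j j g i)
      else 0)"

definition q_since ::
  "real \<Rightarrow> real \<Rightarrow> real \<Rightarrow> (real \<Rightarrow> real) \<Rightarrow> (real \<Rightarrow> real) \<Rightarrow> real \<Rightarrow> real" where
  "q_since T a b f g i =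
     (if a < b
      then 1 / (b - a) *
        (LINT j:{a..b}|lborel. q_historically T {0<..<j} f i * q_previously T j j g i)
      else 0)"

primrec qsem :: "real \<Rightarrow> (real \<Rightarrow> 'p set) \<Rightarrow> 'p mtl \<Rightarrow> real \<Rightarrow> real" where
  "qsem T x (Atom p) = (\<lambda>i. component x p i)"
| "qsem T x (NegAtom p) = (\<lambda>i. 1 - component x p i)"
| "qsem T x (Or \<phi> \<psi>) = (\<lambda>i. max (qsem T x \<phi> i) (qsem T x \<psi> i))"
| "qsem T x (And \<phi> \<psi>) = (\<lambda>i. min (qsem T x \<phi> i) (qsem T x \<psi> i))"
| "qsem T x (Eventually a b \<phi>) = q_eventually T (real a) (real b) (qsem T x \<phi>)"
| "qsem T x (Globally a b \<phi>) = q_globally T {real a..real b} (qsem T x \<phi>)"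
| "qsem T x (Previously a b \<phi>) = q_previously T (real a) (real b) (qsem T x \<phi>)"
| "qsem T x (Historically a b \<phi>) = q_historically T {real a..real b} (qsem T x \<phi>)"
| "qsem T x (Until a b \<phi> \<psi>) = q_until T (real a) (real b) (qsem T x \<phi>) (qsem T x \<psi>)"
| "qsem T x (Since a b \<phi> \<psi>) = q_since T (real a) (real b) (qsem T x \<phi>) (qsem T x \<psi>)"

end

theory Submission
  imports Defs
begin

text \<open>By induction on the formula, the quantitative value is nonnegative everywhere on \<open>[0, T)\<close> and
  vanishes wherever the formula fails. For the temporal operators, failure of the formula makes the
  integrand vanish identically, or makes the infimum of a nonnegative function attain zero. Both
  facts survive for integrands that are not integrable, as their Bochner integral is \<open>0\<close> by
  convention.\<close>

lemma q_inf_nonneg: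
  assumes "\<And>j. j \<in> J \<Longrightarrow> 0 \<le> f j"
  shows "0 \<le> q_inf J f"
  using assms by (auto simp: q_inf_def intro: cINF_greatest)

text \<open>Nonnegativity is used twice: it makes the image bounded below, so that the real
  \<open>INF\<close> is at most \<open>f k\<close>, and it gives the opposite bound.\<close>

lemma q_inf_eq_0:
  assumes "\<And>j. j \<in> J \<Longrightarrow> 0 \<le> f j" and "k \<in> J" and "f k = 0"
  shows "q_inf J f = 0"
proof -
  have "bdd_below (f ` J)"
    using assms(1) by (rule bdd_belowI2)
  then have "(INF j\<in>J. f j) \<le> f k"
    using assms(2) by (rule cINF_lower)
  moreover have "q_inf J f = (INF j\<in>J. f j)"
    using assms(2) by (auto simp: q_inf_def)
  moreover have "0 \<le> q_inf J f"
    using assms(1) by (rule q_inf_nonneg)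
  ultimately show ?thesis
    using assms(3) by simp
qed

lemma set_lebesgue_integral_nonneg_on:
  fixes f :: "'a \<Rightarrow> real"
  assumes "\<And>t. t \<in> A \<Longrightarrow> 0 \<le> f t"
  shows "0 \<le> (LINT t:A|M. f t)"
  unfolding set_lebesgue_integral_def
  using assms by (intro Bochner_Integration.integral_nonneg) (auto simp: indicator_def)

text \<open>Multiplied by the indicator of \<open>A\<close>, the integrand is literally the zero
  function, so no measurability question arises.\<close>

lemma set_lebesgue_integral_eq_0_on:
  fixes f :: "'a \<Rightarrow> real"
  assumes "\<And>t. t \<in> A \<Longrightarrow> f t = 0"
  shows "(LINT t:A|M. f t) = 0"
proof -
  have "(\<lambda>t. indicator A t *\<^sub>R f t) = (\<lambda>t. 0)"
    using assms by (auto simp: indicator_def)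
  then show ?thesis
    by (simp add: set_lebesgue_integral_def)
qed

text \<open>Replaces the image under a shift by a condition on the offset \<open>j - i\<close>,
  which reduces later membership goals to linear arithmetic.\<close>

lemma mem_future_iff: "j \<in> future T i I \<longleftrightarrow> j - i \<in> I \<and> 0 \<le> j \<and> j < T"
  by (force simp: future_def)

lemma mem_past_iff: "j \<in> past T i I \<longleftrightarrow> i - j \<in> I \<and> 0 \<le> j \<and> j < T"
  by (force simp: past_def)

lemma q_eventually_nonneg:
  assumes "\<And>j. j \<in> {0..<T} \<Longrightarrow> 0 \<le> f j"
  shows "0 \<le> q_eventually T a b f i"
  using assms by (auto simp: q_eventually_def w_plus_def intro!: set_lebesgue_integral_nonneg_on)

lemma q_previously_nonneg:
  assumes "\<And>j. j \<in> {0..<T} \<Longrightarrow> 0 \<le> f j"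
  shows "0 \<le> q_previously T a b f i"
  using assms by (auto simp: q_previously_def w_minus_def intro!: set_lebesgue_integral_nonneg_on)

lemma q_globally_nonneg:
  assumes "\<And>j. j \<in> {0..<T} \<Longrightarrow> 0 \<le> f j"
  shows "0 \<le> q_globally T I f i"
  using assms by (auto simp: q_globally_def mem_future_iff intro!: q_inf_nonneg)

lemma q_historically_nonneg:
  assumes "\<And>j. j \<in> {0..<T} \<Longrightarrow> 0 \<le> f j"
  shows "0 \<le> q_historically T I f i"
  using assms by (auto simp: q_historically_def mem_past_iff intro!: q_inf_nonneg)

lemma q_until_nonneg:
  assumes "\<And>j. j \<in> {0..<T} \<Longrightarrow> 0 \<le> f j" and "\<And>j. j \<in> {0..<T} \<Longrightarrow> 0 \<le> g j"
  shows "0 \<le> q_until T a b f g i"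
  using assms unfolding q_until_def
  by (auto intro!: divide_nonneg_pos set_lebesgue_integral_nonneg_on mult_nonneg_nonneg
      q_globally_nonneg q_eventually_nonneg)

lemma q_since_nonneg:
  assumes "\<And>j. j \<in> {0..<T} \<Longrightarrow> 0 \<le> f j" and "\<And>j. j \<in> {0..<T} \<Longrightarrow> 0 \<le> g j"
  shows "0 \<le> q_since T a b f g i"
  using assms unfolding q_since_def
  by (auto intro!: divide_nonneg_pos set_lebesgue_integral_nonneg_on mult_nonneg_nonneg
      q_historically_nonneg q_previously_nonneg)

text \<open>The window \<open>w_plus a b (i - j)\<close> is nonzero only if \<open>j - i\<close>
  lies in \<open>[a, b]\<close>, and there \<open>f\<close> vanishes. Since
  \<open>a \<le> b\<close>, the point-evaluation branch means \<open>a = b\<close>, so its point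
  \<open>i + a\<close> also lies in the window whenever it is in \<open>[0, T)\<close>.\<close>

lemma q_eventually_eq_0:
  assumes "a \<le> b" and "\<And>j. j \<in> future T i {a..b} \<Longrightarrow> f j = 0"
  shows "q_eventually T a b f i = 0"
  using assms unfolding q_eventually_def w_plus_def
  by (auto simp: mem_future_iff intro!: set_lebesgue_integral_eq_0_on)

lemma q_previously_eq_0:
  assumes "a \<le> b" and "\<And>j. j \<in> past T i {a..b} \<Longrightarrow> f j = 0"
  shows "q_previously T a b f i = 0"
  using assms unfolding q_previously_def w_minus_def
  by (auto simp: mem_past_iff intro!: set_lebesgue_integral_eq_0_on)

lemma q_globally_eq_0:
  assumes "\<And>j. j \<in> {0..<T} \<Longrightarrow> 0 \<le> f j" and "k \<in> future T i I" and "f k = 0"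
  shows "q_globally T I f i = 0"
  unfolding q_globally_def using assms
  by (intro q_inf_eq_0[where k = k]) (auto simp: mem_future_iff)

lemma q_historically_eq_0:
  assumes "\<And>j. j \<in> {0..<T} \<Longrightarrow> 0 \<le> f j" and "k \<in> past T i I" and "f k = 0"
  shows "q_historically T I f i = 0"
  unfolding q_historically_def using assms
  by (intro q_inf_eq_0[where k = k]) (auto simp: mem_past_iff)

text \<open>The integrand is a product: at a given offset, either the point value of
  \<open>g\<close> is 0, or a zero of \<open>f\<close> strictly before that point sends the infimum
  to 0.\<close>

lemma q_until_eq_0:
  assumes "0 \<le> i" and "\<And>j. j \<in> {0..<T} \<Longrightarrow> 0 \<le> f j"
    and zero: "\<And>j. j \<in> future T i {a..b} \<Longrightarrow> g j = 0 \<or> (\<exists>k\<in>{i<..<j}. f k = 0)"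
  shows "q_until T a b f g i = 0"
proof -
  have "q_globally T {0<..<j} f i * q_eventually T j j g i = 0" if j: "j \<in> {a..b}" for j
  \<comment> \<open>Here \<open>j\<close> is an offset, while \<open>zero\<close> speaks of absolute
    times, hence \<open>i + j\<close>. If the case condition fails,
    \<open>q_eventually T j j g i\<close> is 0, either by the default outside \<open>[0, T)\<close>
    or because \<open>g\<close> vanishes.\<close>
  proof (cases "i + j \<in> {0..<T} \<and> g (i + j) \<noteq> 0")
    case True
    then obtain k where "k \<in> {i<..<i + j}" and "f k = 0"
      using zero[of "i + j"] j by (auto simp: mem_future_iff)
    \<comment> \<open>The time \<open>k\<close> has offset \<open>k - i\<close> in
      \<open>(0, j)\<close>, and \<open>0 \<le> i < k < i + j < T\<close> keeps it in the
      domain.\<close>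
    then have "q_globally T {0<..<j} f i = 0"
      using assms(1,2) True by (intro q_globally_eq_0[where k = k]) (auto simp: mem_future_iff)
    then show ?thesis by simp
  next
    case False
    then show ?thesis by (auto simp: q_eventually_def)
  qed
  then have "(LINT j:{a..b}|lborel. q_globally T {0<..<j} f i * q_eventually T j j g i) = 0"
    by (rule set_lebesgue_integral_eq_0_on)
  then show ?thesis by (simp add: q_until_def)
qed

text \<open>Time reversal of the argument for \<open>q_until\<close>: now \<open>i < T\<close>
  bounds the witness from above, and \<open>0 \<le> i - j\<close> bounds it from below.\<close>

lemma q_since_eq_0:
  assumes "i < T" and "\<And>j. j \<in> {0..<T} \<Longrightarrow> 0 \<le> f j"
    and zero: "\<And>j. j \<in> past T i {a..b} \<Longrightarrow> g j = 0 \<or> (\<exists>k\<in>{j<..<i}. f k = 0)"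
  shows "q_since T a b f g i = 0"
proof -
  have "q_historically T {0<..<j} f i * q_previously T j j g i = 0" if j: "j \<in> {a..b}" for j
  proof (cases "i - j \<in> {0..<T} \<and> g (i - j) \<noteq> 0")
    case True
    then obtain k where "k \<in> {i - j<..<i}" and "f k = 0"
      using zero[of "i - j"] j by (auto simp: mem_past_iff)
    then have "q_historically T {0<..<j} f i = 0"
      using assms(1,2) True by (intro q_historically_eq_0[where k = k]) (auto simp: mem_past_iff)
    then show ?thesis by simp
  next
    case False
    then show ?thesis by (auto simp: q_previously_def)
  qed
  then have "(LINT j:{a..b}|lborel. q_historically T {0<..<j} f i * q_previously T j j g i) = 0"
    by (rule set_lebesgue_integral_eq_0_on)
  then show ?thesis by (simp add: q_since_def)
qed

text \<open>Provides the lower bound by which a single vanishing argument forces an infimum or a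
  minimum to be exactly 0. The induction varies \<open>i\<close> because temporal operators evaluate
  their arguments at other times.\<close>

lemma qsem_nonneg: "i \<in> {0..<T} \<Longrightarrow> 0 \<le> qsem T x \<phi> i"
proof (induction \<phi> arbitrary: i)
  case (Atom p)
  then show ?case by (simp add: component_def)
next
  case (NegAtom p)
  then show ?case by (simp add: component_def)
next
  case (Or \<phi> \<psi>)
  then show ?case by (simp add: le_max_iff_disj)
next
  case (And \<phi> \<psi>)
  then show ?case by simp
next
  case (Eventually a b \<phi>)
  show ?case
    unfolding qsem.simps by (intro q_eventually_nonneg Eventually.IH)
next
  case (Globally a b \<phi>)
  show ?case
    unfolding qsem.simps by (intro q_globally_nonneg Globally.IH)
next
  case (Previously a b \<phi>)
  show ?case
    unfolding qsem.simps by (intro q_previously_nonneg Previously.IH)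
next
  case (Historically a b \<phi>)
  show ?case
    unfolding qsem.simps by (intro q_historically_nonneg Historically.IH)
next
  case (Until a b \<phi> \<psi>)
  show ?case
    unfolding qsem.simps by (intro q_until_nonneg Until.IH)
next
  case (Since a b \<phi> \<psi>)
  show ?case
    unfolding qsem.simps by (intro q_since_nonneg Since.IH)
qed

lemma qsem_eq_0_if_not_sat:
  assumes "proper_intervals \<phi>" and "i \<in> {0..<T}" and "\<not> sat T x \<phi> i"
  shows "qsem T x \<phi> i = 0"
  using assms
proof (induction \<phi> arbitrary: i)
  case (Atom p)
  then show ?case by (simp add: component_def split: if_splits)
next
  case (NegAtom p)
  then show ?case by simp
next
  case (Or \<phi> \<psi>)
  then show ?case by simp
next
  case (And \<phi> \<psi>)
  then have "qsem T x \<phi> i = 0 \<or> qsem T x \<psi> i = 0" by auto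
  \<comment> \<open>One conjunct has value 0; the bound on the other keeps the minimum from being
    negative.\<close>
  moreover have "0 \<le> qsem T x \<phi> i" "0 \<le> qsem T x \<psi> i"
    using And.prems(2) by (auto intro: qsem_nonneg)
  ultimately show ?case by auto
next
  case (Eventually a b \<phi>)
  then show ?case by (auto simp: mem_future_iff intro!: q_eventually_eq_0)
next
  case (Previously a b \<phi>)
  then show ?case by (auto simp: mem_past_iff intro!: q_previously_eq_0)
next
  case (Globally a b \<phi>)
  \<comment> \<open>By the induction hypothesis the value at \<open>k\<close> is 0, so the infimum
    is attained there.\<close>
  then obtain k where "k \<in> future T i {real a..real b}" and "\<not> sat T x \<phi> k" by auto
  with Globally show ?case
    by (auto simp: mem_future_iff intro!: q_globally_eq_0[where k = k] qsem_nonneg)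
next
  case (Historically a b \<phi>)
  then obtain k where "k \<in> past T i {real a..real b}" and "\<not> sat T x \<phi> k" by auto
  with Historically show ?case
    by (auto simp: mem_past_iff intro!: q_historically_eq_0[where k = k] qsem_nonneg)
next
  case (Until a b \<phi> \<psi>)
  have "qsem T x \<psi> j = 0 \<or> (\<exists>k\<in>{i<..<j}. qsem T x \<phi> k = 0)"
    if j: "j \<in> future T i {real a..real b}" for j
  proof (cases "sat T x \<psi> j")
    case True
    then obtain k where "k \<in> {i<..<j}" and "\<not> sat T x \<phi> k"
      using Until.prems(3) j by auto
    \<comment> \<open>Being between \<open>i\<close> and \<open>j\<close>, both in
      \<open>[0, T)\<close>, the time \<open>k\<close> is one to which the induction hypothesis
      applies.\<close>
    moreover have "k \<in> {0..<T}"
      using \<open>k \<in> {i<..<j}\<close> Until.prems(2) j by (auto simp: mem_future_iff)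
    ultimately have "qsem T x \<phi> k = 0"
      using Until.IH(1) Until.prems(1) by simp
    then show ?thesis
      using \<open>k \<in> {i<..<j}\<close> by blast
  next
    case False
    then show ?thesis
      using Until.IH(2) Until.prems(1) j by (auto simp: mem_future_iff)
  qed
  then show ?case
    using Until.prems(2) by (auto intro!: q_until_eq_0 qsem_nonneg)
next
  case (Since a b \<phi> \<psi>)
  have "qsem T x \<psi> j = 0 \<or> (\<exists>k\<in>{j<..<i}. qsem T x \<phi> k = 0)"
    if j: "j \<in> past T i {real a..real b}" for j
  proof (cases "sat T x \<psi> j")
    case True
    then obtain k where "k \<in> {j<..<i}" and "\<not> sat T x \<phi> k"
      using Since.prems(3) j by auto
    moreover have "k \<in> {0..<T}"
      using \<open>k \<in> {j<..<i}\<close> Since.prems(2) j by (auto simp: mem_past_iff)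
    ultimately have "qsem T x \<phi> k = 0"
      using Since.IH(1) Since.prems(1) by simp
    then show ?thesis
      using \<open>k \<in> {j<..<i}\<close> by blast
  next
    case False
    then show ?thesis
      using Since.IH(2) Since.prems(1) j by (auto simp: mem_past_iff)
  qed
  then show ?case
    using Since.prems(2) by (auto intro!: q_since_eq_0 qsem_nonneg)
qed

theorem theorem4:
  fixes P :: "'p set" and T :: real and x :: "real \<Rightarrow> 'p set" and \<phi> :: "'p mtl"
  assumes "finite P"
    and "T > 0"
    and "pc_cadlag_signal P T x"
    and "atoms \<phi> \<subseteq> P"
    and "proper_intervals \<phi>"
  shows "\<forall>i\<in>{0..<T}. (qsem T x \<phi> i > 0 \<longrightarrow> sat T x \<phi> i) \<and>
                      (\<not> sat T x \<phi> i \<longrightarrow> qsem T x \<phi> i = 0)"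
proof (intro ballI)
  fix i assume "i \<in> {0..<T}"
  then have "qsem T x \<phi> i = 0" if "\<not> sat T x \<phi> i"
    using qsem_eq_0_if_not_sat assms(5) that by blast
  \<comment> \<open>A positive value is not 0, so the first implication follows from the second by
    contraposition.\<close>
  then show "(qsem T x \<phi> i > 0 \<longrightarrow> sat T x \<phi> i) \<and> (\<not> sat T x \<phi> i \<longrightarrow> qsem T x \<phi> i = 0)"
    by fastforce
qed

end
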